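(* Let the integers $P^\ast(n)$, $n\ge 0$, be defined by $\sum_{n\geq 0}P^\ast(n)q^n=f_1^4f_5^4$. Then for all integers $n\geq 0$ and $\alpha\geq 1$, \[ P^\ast(2^\alpha n+2^\alpha -1)\equiv 0 \pmod{2^{\alpha+1}}. \]
   Context: For a positive integer $k$, $f_k:=(q^k;q^k)_\infty=\prod_{i\geq 1}(1-q^{ki})$, regarded as a formal power series in $q$ with integer coefficients. *)

theory Defs
  imports "HOL-Analysis.Analysis" "HOL-Number_Theory.Cong"
begin

text \<open>
  The infinite product is taken in the ring of formal power series over the integers with its
  usual topology (coefficientwise eventual equality). The index of \<^const>\<open>prodinf\<close> starts at 0,
  so its \<open>i\<close>-th factor is \<open>1 - q ^ (k * (i + 1))\<close>.
\<close>
definition euler_prod :: "nat \<Rightarrow> int fps" where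
  "euler_prod k = (\<Prod>i. 1 - fps_X ^ (k * Suc i))"

text \<open>For positive \<open>k\<close> the product converges, so \<^const>\<open>prodinf\<close> denotes its actual limit.\<close>
lemma euler_prod_has_prod:
  assumes "k > 0"
  shows "(\<lambda>i. 1 - fps_X ^ (k * Suc i)) has_prod euler_prod k"
proof -
  define P :: "nat \<Rightarrow> int fps" where "P N = (\<Prod>i\<le>N. 1 - fps_X ^ (k * Suc i))" for N
  define L where "L = Abs_fps (\<lambda>n. fps_nth (P n) n)"
  have step: "fps_nth (P (Suc N)) n = fps_nth (P N) n" if "n \<le> N" for n N
  proof -
    have "n < Suc (Suc N)"
      using that by simp
    also have "Suc (Suc N) \<le> k * Suc (Suc N)"
      using assms by (cases k) simp_all
    finally have "n < k * Suc (Suc N)" .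
    moreover have "P (Suc N) = P N - P N * fps_X ^ (k * Suc (Suc N))"
      by (simp add: P_def right_diff_distrib del: mult_Suc_right)
    ultimately show ?thesis
      by (simp add: fps_X_power_mult_right_nth del: mult_Suc_right)
  qed
  have const: "fps_nth (P N) n = fps_nth L n" if "n \<le> N" for n N
    using that by (induction N rule: dec_induct) (simp_all add: L_def step)
  have "P \<longlonglongrightarrow> L"
  proof (rule tendsto_fpsI)
    fix n
    show "\<forall>\<^sub>F N in sequentially. fps_nth (P N) n = fps_nth L n"
      using const by (intro eventually_sequentiallyI[of n]) simp
  qed
  moreover have "L \<noteq> 0"
  proof -
    have "fps_nth L 0 = 1"
      using assms by (simp add: L_def P_def)
    then show ?thesis by auto
  qed
  ultimately have "(\<lambda>i. 1 - fps_X ^ (k * Suc i)) has_prod L"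
    unfolding has_prod_def raw_has_prod_def P_def by simp
  then show ?thesis
    unfolding euler_prod_def using has_prod_unique by metis
qed

definition Pstar :: "nat \<Rightarrow> int" where
  "Pstar n = fps_nth (euler_prod 1 ^ 4 * euler_prod 5 ^ 4) n"

end

theory Submission
  imports Defs "HOL-Computational_Algebra.Formal_Laurent_Series"
begin

text \<open>
  Put \<open>a(n) = P\<^sup>*(n - 1)\<close>, the coefficient of \<open>q^n\<close> in \<open>q f\<^sub>1\<^sup>4 f\<^sub>5\<^sup>4 = \<eta>(\<tau>)\<^sup>4 \<eta>(5 \<tau>)\<^sup>4\<close>. This is
  a Hecke eigenform of weight 4 and level 5 with \<open>a(2) = -4\<close>, so \<open>a(2 n) = -4 a(n) - 8 a(n / 2)\<close>,
  where the last term is absent for odd \<open>n\<close>. The index \<open>2^\<alpha> n + 2^\<alpha> - 1\<close> belongs to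
  \<open>a(2^\<alpha> (n + 1))\<close>, and the recursion gives the divisibility by induction on \<open>\<alpha>\<close>: 4 divides
  \<open>a(2 n)\<close>, and each further doubling raises the guaranteed power of 2 by one.

  The Hecke relation (lemma \<open>Pstar_odd\<close>) is proved here by elementary theta function identities.
  With \<open>\<phi>(q) = \<Sum> q^(k\<^sup>2)\<close> over all integers \<open>k\<close> and \<open>\<psi>(q) = \<Sum> q^(k (k + 1) / 2)\<close> over \<open>k \<ge> 0\<close>, the
  products \<open>f\<^sub>1\<^sup>2 = \<phi>(-q) f\<^sub>2\<close> and \<open>\<phi>(-q)\<^sup>2 = \<phi>(q\<^sup>2)\<^sup>2 - 4 q \<psi>(q\<^sup>4)\<^sup>2\<close> isolate the odd part of
  \<open>f\<^sub>1\<^sup>4 f\<^sub>5\<^sup>4\<close>. It becomes a combination of Euler products by means of the identity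
  \<open>\<psi>(q\<^sup>2) \<phi>(q\<^sup>5) - q \<phi>(q) \<psi>(q^10) = f\<^sub>1 f\<^sub>5\<close>. Both sides of the latter are sums over
  representations by the norm form \<open>x\<^sup>2 + 5 y\<^sup>2\<close> with the sign \<open>(-1)^y\<close> (lemmas
  \<open>odd_lattice_theta\<close> and \<open>odd_lattice_euler_prod\<close>); the right hand side is brought to this form
  by the pentagonal number theorem and division by \<open>1 + \<surd>(-5)\<close>.

  The product expansions of the theta functions all come from Jacobi's triple product
  (\<open>jacobi_triple_product\<close>), obtained as a limit of a finite identity with Gaussian binomial
  coefficients. Theta functions are generating functions of weighted families indexed by \<open>\<int>\<close> or
  \<open>\<int>\<^sup>2\<close>, so that all relations between them reduce to bijections of lattices.
\<close>

section \<open>Generating functions of weighted families\<close>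

text \<open>
  Exponents are integers, so that quadratic forms can be written without truncation. The condition
  ensures that the formal sum of \<open>s i q^(e i)\<close> over \<open>i \<in> I\<close> is a power series and that products of
  such sums may be expanded termwise.
\<close>
definition finite_below :: "'a set \<Rightarrow> ('a \<Rightarrow> int) \<Rightarrow> bool" where
  "finite_below I e \<longleftrightarrow> (\<forall>i\<in>I. 0 \<le> e i) \<and> (\<forall>N. finite {i \<in> I. e i \<le> N})"

definition gen_fun :: "'a set \<Rightarrow> ('a \<Rightarrow> int) \<Rightarrow> ('a \<Rightarrow> int) \<Rightarrow> int fps" where
  "gen_fun I e s = Abs_fps (\<lambda>N. \<Sum>i | i \<in> I \<and> e i = int N. s i)"

lemma finite_below_fibre:
  assumes "finite_below I e"
  shows "finite {i \<in> I. e i = N}"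
proof (rule finite_subset)
  show "{i \<in> I. e i = N} \<subseteq> {i \<in> I. e i \<le> N}" by auto
  show "finite {i \<in> I. e i \<le> N}" using assms by (simp add: finite_below_def)
qed

lemma finite_below_subset:
  assumes "finite_below I e" "J \<subseteq> I"
  shows "finite_below J e"
proof -
  have "finite {j \<in> J. e j \<le> N}" for N
  proof (rule finite_subset)
    show "{j \<in> J. e j \<le> N} \<subseteq> {i \<in> I. e i \<le> N}" using assms(2) by auto
  qed (use assms(1) in \<open>simp add: finite_below_def\<close>)
  then show ?thesis using assms by (auto simp: finite_below_def)
qed

lemma finite_below_Times:
  assumes "finite_below I e" "finite_below J e'"
  shows "finite_below (I \<times> J) (\<lambda>(i, j). e i + e' j)"
  unfolding finite_below_def
proof (intro conjI allI ballI)
  fix N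
  have "{p \<in> I \<times> J. (case p of (i, j) \<Rightarrow> e i + e' j) \<le> N} \<subseteq> {i \<in> I. e i \<le> N} \<times> {j \<in> J. e' j \<le> N}"
    using assms by (force simp: finite_below_def)
  then show "finite {p \<in> I \<times> J. (case p of (i, j) \<Rightarrow> e i + e' j) \<le> N}"
    by (rule finite_subset) (use assms in \<open>simp add: finite_below_def\<close>)
qed (use assms in \<open>auto simp: finite_below_def\<close>)

text \<open>
  The relations between theta functions below rest on changes of variables in a lattice. This
  lemma applies to them once the exponents are compared as quadratic polynomials.
\<close>
lemma gen_fun_bij:
  assumes h: "bij_betw h I J"
    and e: "\<And>i. i \<in> I \<Longrightarrow> e' (h i) = e i" and s: "\<And>i. i \<in> I \<Longrightarrow> s' (h i) = s i"
  shows "gen_fun I e s = gen_fun J e' s'"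
proof (rule fps_ext)
  fix N
  have "bij_betw h {i \<in> I. e i = int N} {j \<in> J. e' j = int N}"
    using h e by (auto simp: bij_betw_def inj_on_def)
  from sum.reindex_bij_betw[OF this, of s']
  show "fps_nth (gen_fun I e s) N = fps_nth (gen_fun J e' s') N"
    using s by (simp add: gen_fun_def)
qed

lemma gen_fun_cong:
  assumes "I = J" "\<And>i. i \<in> J \<Longrightarrow> e i = e' i" "\<And>i. i \<in> J \<Longrightarrow> s i = s' i"
  shows "gen_fun I e s = gen_fun J e' s'"
  unfolding assms(1) by (rule gen_fun_bij[OF bij_betw_id]) (simp_all add: assms(2,3))

lemma gen_fun_Un:
  assumes "finite_below (I \<union> J) e" "I \<inter> J = {}"
  shows "gen_fun (I \<union> J) e s = gen_fun I e s + gen_fun J e s"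
proof (rule fps_ext)
  fix N
  have "{i \<in> I \<union> J. e i = int N} = {i \<in> I. e i = int N} \<union> {i \<in> J. e i = int N}" by auto
  moreover have "finite {i \<in> I. e i = int N}" "finite {i \<in> J. e i = int N}"
    using finite_below_fibre[OF finite_below_subset[OF assms(1)]] by auto
  ultimately show "fps_nth (gen_fun (I \<union> J) e s) N = fps_nth (gen_fun I e s + gen_fun J e s) N"
    using assms(2) by (simp add: gen_fun_def) (subst sum.union_disjoint, auto)
qed

lemma gen_fun_mult:
  assumes "finite_below I e" "finite_below J e'"
  shows "gen_fun I e s * gen_fun J e' s' = gen_fun (I \<times> J) (\<lambda>(i, j). e i + e' j) (\<lambda>(i, j). s i * s' j)"
proof (rule fps_ext)
  fix N
  let ?F = "\<lambda>k. {i \<in> I. e i = int k}" and ?G = "\<lambda>k. {j \<in> J. e' j = int k}"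
  have fin: "finite (?F k)" "finite (?G k)" for k
    by (rule finite_below_fibre[OF assms(1)], rule finite_below_fibre[OF assms(2)])
  have "{p \<in> I \<times> J. (case p of (i, j) \<Rightarrow> e i + e' j) = int N} = (\<Union>k\<in>{0..N}. ?F k \<times> ?G (N - k))"
    (is "?L = ?R")
  proof
    show "?L \<subseteq> ?R"
    proof clarify
      fix i j assume ij: "i \<in> I" "j \<in> J" "e i + e' j = int N"
      with assms have "0 \<le> e i" "0 \<le> e' j" by (auto simp: finite_below_def)
      with ij show "(i, j) \<in> ?R"
        by (intro UN_I[of "nat (e i)"]) auto
    qed
  qed (auto)
  then have "fps_nth (gen_fun (I \<times> J) (\<lambda>(i, j). e i + e' j) (\<lambda>(i, j). s i * s' j)) N
      = (\<Sum>p\<in>(\<Union>k\<in>{0..N}. ?F k \<times> ?G (N - k)). case p of (i, j) \<Rightarrow> s i * s' j)"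
    by (simp add: gen_fun_def)
  also have "\<dots> = (\<Sum>k=0..N. \<Sum>p\<in>?F k \<times> ?G (N - k). case p of (i, j) \<Rightarrow> s i * s' j)"
  proof (rule sum.UNION_disjoint)
    show "\<forall>k\<in>{0..N}. finite (?F k \<times> ?G (N - k))" by (intro ballI finite_cartesian_product fin)
    show "\<forall>k\<in>{0..N}. \<forall>l\<in>{0..N}. k \<noteq> l \<longrightarrow> (?F k \<times> ?G (N - k)) \<inter> (?F l \<times> ?G (N - l)) = {}"
      by auto
  qed simp
  also have "\<dots> = (\<Sum>k=0..N. (\<Sum>i\<in>?F k. s i) * (\<Sum>j\<in>?G (N - k). s' j))"
    by (simp add: sum_product sum.cartesian_product)
  also have "\<dots> = fps_nth (gen_fun I e s * gen_fun J e' s') N"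
    by (simp add: fps_mult_nth gen_fun_def)
  finally show "fps_nth (gen_fun I e s * gen_fun J e' s') N =
      fps_nth (gen_fun (I \<times> J) (\<lambda>(i, j). e i + e' j) (\<lambda>(i, j). s i * s' j)) N" ..
qed

lemma gen_fun_shift:
  assumes "finite_below I e"
  shows "fps_X ^ m * gen_fun I e s = gen_fun I (\<lambda>i. e i + int m) s"
proof (rule fps_ext)
  fix N
  show "fps_nth (fps_X ^ m * gen_fun I e s) N = fps_nth (gen_fun I (\<lambda>i. e i + int m) s) N"
  proof (cases "N < m")
    case True
    then have "{i \<in> I. e i + int m = int N} = {}"
      using assms by (force simp: finite_below_def)
    with True show ?thesis by (simp add: gen_fun_def fps_X_power_mult_nth del: Collect_empty_eq)
  next
    case False
    then have "{i \<in> I. e i + int m = int N} = {i \<in> I. e i = int (N - m)}" by auto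
    with False show ?thesis by (simp add: gen_fun_def fps_X_power_mult_nth)
  qed
qed

lemma gen_fun_uminus: "gen_fun I e (\<lambda>i. - s i) = - gen_fun I e s"
  by (rule fps_ext) (simp add: gen_fun_def sum_negf)

lemma gen_fun_sign_reversing:
  assumes "bij_betw h I I" "\<And>i. i \<in> I \<Longrightarrow> e (h i) = e i" "\<And>i. i \<in> I \<Longrightarrow> s (h i) = - s i"
  shows "gen_fun I e s = 0"
proof -
  have "gen_fun I e (\<lambda>i. - s i) = gen_fun I e s"
    by (rule gen_fun_bij[OF assms(1)]) (use assms in auto)
  then have "fps_nth (gen_fun I e s) N = 0" for N
    by (simp add: gen_fun_uminus fps_eq_iff)
  then show ?thesis by (simp add: fps_eq_iff)
qed

lemma gen_fun_compose_X_power: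
  assumes "d > 0"
  shows "gen_fun I e s oo fps_X ^ d = gen_fun I (\<lambda>i. int d * e i) s"
proof (rule fps_ext)
  fix N
  show "fps_nth (gen_fun I e s oo fps_X ^ d) N = fps_nth (gen_fun I (\<lambda>i. int d * e i) s) N"
  proof (cases "d dvd N")
    case True
    then have "int N = int d * int (N div d)" by (metis dvd_mult_div_cancel of_nat_mult)
    then have "{i \<in> I. int d * e i = int N} = {i \<in> I. e i = int (N div d)}"
      using assms by auto
    with True show ?thesis by (simp add: gen_fun_def fps_nth_compose_X_power)
  next
    case False
    then have "int N \<noteq> int d * t" for t
      by (metis dvd_triv_left of_nat_dvd_iff)
    then have "{i \<in> I. int d * e i = int N} = {}" by (auto simp: eq_commute)
    with False show ?thesis by (simp add: gen_fun_def fps_nth_compose_X_power del: Collect_empty_eq)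
  qed
qed

section \<open>Limits of formal power series\<close>

lemma tendsto_fps_mult:
  fixes f g :: "'b \<Rightarrow> 'a :: ring_1 fps"
  assumes "(f \<longlongrightarrow> F) G" "(g \<longlongrightarrow> F') G"
  shows "((\<lambda>x. f x * g x) \<longlongrightarrow> F * F') G"
  unfolding tendsto_fps_iff
proof
  fix n
  have "eventually (\<lambda>x. \<forall>k\<in>{..n}. fps_nth (f x) k = fps_nth F k) G"
    "eventually (\<lambda>x. \<forall>k\<in>{..n}. fps_nth (g x) k = fps_nth F' k) G"
    using assms by (auto simp: eventually_ball_finite_distrib tendsto_fps_iff)
  then show "eventually (\<lambda>x. fps_nth (f x * g x) n = fps_nth (F * F') n) G"
    by eventually_elim (simp add: fps_mult_nth)
qed

lemma fps_X_power_dvd_iff: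
  fixes f :: "'a :: comm_ring_1 fps"
  shows "fps_X ^ M dvd f \<longleftrightarrow> (\<forall>i<M. fps_nth f i = 0)"
proof
  assume "\<forall>i<M. fps_nth f i = 0"
  then have "f = fps_X ^ M * fps_shift M f"
    by (intro fps_ext) (auto simp: fps_X_power_mult_nth)
  then show "fps_X ^ M dvd f" by (metis dvd_triv_left)
next
  assume "fps_X ^ M dvd f"
  then obtain g where "f = fps_X ^ M * g" by (rule dvdE)
  then show "\<forall>i<M. fps_nth f i = 0" by (simp add: fps_X_power_mult_nth)
qed

section \<open>The finite form of Jacobi's triple product\<close>

text \<open>
  The Gaussian binomial coefficient. Pascal's recursion defines it in every commutative ring,
  where the quotient of products \<open>(1 - Q) (1 - Q\<^sup>2) \<dots>\<close> need not make sense.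
\<close>
fun gauss_binomial :: "'a :: comm_ring_1 \<Rightarrow> nat \<Rightarrow> nat \<Rightarrow> 'a" where
  "gauss_binomial Q n 0 = 1"
| "gauss_binomial Q 0 (Suc k) = 0"
| "gauss_binomial Q (Suc n) (Suc k) = gauss_binomial Q n k + Q ^ Suc k * gauss_binomial Q n (Suc k)"

definition qpoch :: "'a :: comm_ring_1 \<Rightarrow> nat \<Rightarrow> 'a" where
  "qpoch Q n = (\<Prod>j<n. 1 - Q ^ Suc j)"

lemma qpoch_0 [simp]: "qpoch Q 0 = 1" and qpoch_Suc: "qpoch Q (Suc n) = qpoch Q n * (1 - Q ^ Suc n)"
  by (simp_all add: qpoch_def)

lemma gauss_binomial_eq_0 [simp]: "n < k \<Longrightarrow> gauss_binomial Q n k = 0"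
  by (induction Q n k rule: gauss_binomial.induct) auto

lemma gauss_binomial_self [simp]: "gauss_binomial Q n n = 1"
  by (induction n) auto

text \<open>
  The mirror image of the defining recursion. The two recursions serve to extend the two products
  in the finite triple product, one for each kind of factor.
\<close>
lemma gauss_binomial_Suc_Suc':
  "k \<le> n \<Longrightarrow> gauss_binomial Q (Suc n) (Suc k)
      = Q ^ (n - k) * gauss_binomial Q n k + gauss_binomial Q n (Suc k)"
proof (induction n arbitrary: k)
  case 0
  then show ?case by simp
next
  case (Suc n)
  show ?case
  proof (cases k)
    case 0
    have "gauss_binomial Q (Suc n) (Suc 0) = Q ^ n + gauss_binomial Q n (Suc 0)"
      using Suc.IH[of 0] by simp
    then show ?thesis using 0 by (simp add: algebra_simps)
  next
    case (Suc k')
    show ?thesis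
    proof (cases "k' = n")
      case True
      then show ?thesis using Suc by simp
    next
      case False
      then have "k' < n" using Suc Suc.prems \<open>k = Suc k'\<close> by simp
      then obtain d where d: "n = k' + Suc d" by (metis less_imp_Suc_add add_Suc_right)
      have 1: "gauss_binomial Q (Suc n) (Suc k')
          = Q ^ Suc d * gauss_binomial Q n k' + gauss_binomial Q n (Suc k')"
        using Suc.IH[of k'] d by simp
      have 2: "gauss_binomial Q (Suc n) (Suc (Suc k'))
          = Q ^ d * gauss_binomial Q n (Suc k') + gauss_binomial Q n (Suc (Suc k'))"
        using Suc.IH[of "Suc k'"] d by simp
      have 3: "gauss_binomial Q (Suc n) (Suc k')
          = gauss_binomial Q n k' + Q ^ Suc k' * gauss_binomial Q n (Suc k')"
        "gauss_binomial Q (Suc n) (Suc (Suc k'))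
            = gauss_binomial Q n (Suc k') + Q ^ Suc (Suc k') * gauss_binomial Q n (Suc (Suc k'))"
        by simp_all
      have "gauss_binomial Q (Suc (Suc n)) (Suc (Suc k')) =
          gauss_binomial Q (Suc n) (Suc k') + Q ^ Suc (Suc k') * gauss_binomial Q (Suc n)
              (Suc (Suc k'))"
        by simp
      also have "\<dots> = (Q ^ Suc d * gauss_binomial Q n k' + gauss_binomial Q n (Suc k'))
          + Q ^ Suc (Suc k') * (Q ^ d * gauss_binomial Q n (Suc k') + gauss_binomial Q n
              (Suc (Suc k')))"
        by (simp only: 1 2)
      also have "\<dots> = Q ^ Suc d * (gauss_binomial Q n k' + Q ^ Suc k' * gauss_binomial Q n (Suc k'))
          + (gauss_binomial Q n (Suc k') + Q ^ Suc (Suc k') * gauss_binomial Q n (Suc (Suc k')))"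
        by (simp add: algebra_simps power_add)
      also have "\<dots> = Q ^ Suc d * gauss_binomial Q (Suc n) (Suc k')
          + gauss_binomial Q (Suc n) (Suc (Suc k'))"
        by (simp only: 3)
      finally show ?thesis using d Suc by simp
    qed
  qed
qed

lemma gauss_binomial_qpoch:
  "gauss_binomial Q (i + j) i * qpoch Q i * qpoch Q j = qpoch Q (i + j)"
proof (induction "i + j" arbitrary: i j)
  case 0
  then show ?case by simp
next
  case (Suc n)
  show ?case
  proof (cases i; cases j)
    fix i' j' assume ij: "i = Suc i'" "j = Suc j'"
    have n: "n = i' + Suc j'" "n = Suc i' + j'" using Suc.hyps(2) ij by auto
    have 1: "gauss_binomial Q n i' * qpoch Q i' * qpoch Q (Suc j') = qpoch Q n"
      using Suc.hyps(1)[OF n(1)] n by simp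
    have 2: "gauss_binomial Q n (Suc i') * qpoch Q (Suc i') * qpoch Q j' = qpoch Q n"
      using Suc.hyps(1)[OF n(2)] n by simp
    have "gauss_binomial Q (Suc n) (Suc i') * qpoch Q (Suc i') * qpoch Q (Suc j')
       = (gauss_binomial Q n i' * qpoch Q i' * qpoch Q (Suc j')) * (1 - Q ^ Suc i')
       + Q ^ Suc i' * (gauss_binomial Q n (Suc i') * qpoch Q (Suc i') * qpoch Q j') * (1 - Q ^ Suc j')"
      by (simp add: qpoch_Suc algebra_simps)
    also have "\<dots> = qpoch Q n * (1 - Q ^ Suc n)"
    proof -
      have "Q ^ Suc n = Q ^ Suc i' * Q ^ Suc j'" unfolding n(1) by (simp add: power_add)
      then show ?thesis unfolding 1 2 by (simp only: algebra_simps mult_1_left)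
    qed
    finally show ?thesis using ij n by (simp add: qpoch_Suc)
  qed (use Suc in auto)
qed

definition triangular :: "int \<Rightarrow> int" where "triangular k = k * (k + 1) div 2"

lemma two_triangular: "2 * triangular k = k * (k + 1)"
  by (simp add: triangular_def)

lemma triangular_nonneg [simp]: "0 \<le> triangular k"
proof -
  have "0 \<le> k * (k + 1)" by (cases "k \<ge> 0") (auto simp: mult_nonpos_nonpos)
  then show ?thesis by (simp add: triangular_def)
qed

lemma triangular_eq_diff: "triangular k = triangular (k - 1) + k"
proof -
  have "2 * triangular k = 2 * (triangular (k - 1) + k)"
      using two_triangular[of k] two_triangular[of "k-1"] by (simp add: algebra_simps)
  then show ?thesis by simp
qed

text \<open>
  The general term of Ramanujan's theta function \<open>f(a, b)\<close>. Its exponents stay nonnegative for all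
  integers \<open>k\<close>, so no inverse of \<open>a\<close> or \<open>b\<close> is involved.
\<close>
definition theta_term :: "'a :: comm_ring_1 \<Rightarrow> 'a \<Rightarrow> int \<Rightarrow> 'a" where
  "theta_term a b k = a ^ nat (triangular k) * b ^ nat (triangular (k - 1))"

lemma theta_term_Suc_a:
  assumes "k \<le> int m"
  shows "theta_term a b k * (a * (a * b) ^ m) = theta_term a b (k + 1) * (a * b) ^ nat (int m - k)"
proof -
  have "nat (triangular k) + 1 + m = nat (triangular (k + 1)) + nat (int m - k)"
    using assms triangular_eq_diff[of "k + 1", simplified] triangular_nonneg[of k]
        triangular_nonneg[of "k+1"] by linarith
  moreover have "nat (triangular (k - 1)) + m = nat (triangular k) + nat (int m - k)"
    using assms triangular_eq_diff[of k] triangular_nonneg[of k] triangular_nonneg[of "k-1"] by linarith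
  ultimately have "a ^ (nat (triangular k) + 1 + m) * b ^ (nat (triangular (k - 1)) + m) =
    a ^ (nat (triangular (k + 1)) + nat (int m - k)) * b ^ (nat (triangular k) + nat (int m - k))"
    by simp
  then show ?thesis by (simp add: theta_term_def power_add power_mult_distrib mult_ac)
qed

lemma theta_term_swap: "theta_term a b k = theta_term b a (- k)"
proof -
  have "triangular (- k) = triangular (k - 1)" "triangular (- k - 1) = triangular k"
    by (simp_all add: triangular_def algebra_simps)
  then show ?thesis by (simp add: theta_term_def mult.commute)
qed

lemma theta_term_Suc_b:
  assumes "- k \<le> int n"
  shows "theta_term a b k * (b * (a * b) ^ n) = theta_term a b (k - 1) * (a * b) ^ nat (int n + k)"
  using theta_term_Suc_a[OF assms, of b a] theta_term_swap[of a b k] theta_term_swap[of a b "k - 1"]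
  by (simp add: mult.commute)

text \<open>
  A new factor \<open>1 + a Q^m\<close> or \<open>1 + b Q^n\<close>, with \<open>Q = a b\<close>, moves each theta term to its neighbour,
  up to a power of \<open>Q\<close> that is precisely the one in Pascal's recursion. Keeping the numbers \<open>m\<close>
  and \<open>n\<close> of factors independent is what allows them to be added one at a time.
\<close>
lemma finite_jacobi_triple_product:
  "(\<Prod>j<m. 1 + a * (a * b) ^ j) * (\<Prod>j<n. 1 + b * (a * b) ^ j)
     = (\<Sum>k\<le>m + n. gauss_binomial (a * b) (m + n) k * theta_term a b (int k - int n))"
proof (induction m)
  case 0
  show ?case
  proof (induction n)
    case 0
    then show ?case by (simp add: theta_term_def triangular_def)
  next
    case (Suc n)
    let ?g = "gauss_binomial (a * b)" and ?T = "theta_term a b" and ?q = "a * b"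
    have *: "?g n k * ?T (int k - int n) * (b * ?q ^ n) = ?q ^ k * ?g n k * ?T (int k - int (Suc n))" if
        "k \<le> n" for k
      using theta_term_Suc_b[of "int k - int n" n a b] by (simp add: algebra_simps)
    have "(\<Prod>j<0. 1 + a * ?q ^ j) * (\<Prod>j<Suc n. 1 + b * ?q ^ j)
      = (\<Sum>k\<le>n. ?g n k * ?T (int k - int n)) * (1 + b * ?q ^ n)"
      using Suc.IH by simp
    also have "\<dots> = (\<Sum>k\<le>n. ?g n k * ?T (int k - int n))
        + (\<Sum>k\<le>n. ?q ^ k * ?g n k * ?T (int k - int (Suc n)))"
      unfolding distrib_left mult_1_right sum_distrib_right
      by (intro arg_cong2[where f = "(+)"] refl sum.cong) (simp only: atMost_iff *)
    also have "(\<Sum>k\<le>n. ?q ^ k * ?g n k * ?T (int k - int (Suc n)))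
        = (\<Sum>k\<le>Suc n. ?q ^ k * ?g n k * ?T (int k - int (Suc n)))" by simp
    also have "\<dots> = ?T (- int (Suc n)) + (\<Sum>k\<le>n. ?q ^ Suc k * ?g n (Suc k) * ?T (int k - int n))"
      by (subst sum.atMost_Suc_shift) (simp add: algebra_simps)
    also have "(\<Sum>k\<le>n. ?g n k * ?T (int k - int n))
        + (?T (- int (Suc n)) + (\<Sum>k\<le>n. ?q ^ Suc k * ?g n (Suc k) * ?T (int k - int n)))
      = ?T (- int (Suc n)) + (\<Sum>k\<le>n. ?g (Suc n) (Suc k) * ?T (int k - int n))"
      by (simp add: algebra_simps sum.distrib)
    also have "\<dots> = (\<Sum>k\<le>Suc n. ?g (Suc n) k * ?T (int k - int (Suc n)))"
      by (subst sum.atMost_Suc_shift) (simp add: algebra_simps)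
    finally show ?case by simp
  qed
next
  case (Suc m)
  let ?g = "gauss_binomial (a * b)" and ?T = "theta_term a b" and ?q = "a * b" and ?N = "m + n"
  have *: "?g ?N k * ?T (int k - int n) * (a * ?q ^ m)
      = ?q ^ (?N - k) * ?g ?N k * ?T (int (Suc k) - int n)" if "k \<le> ?N" for k
  proof -
    have "int k - int n \<le> int m" "nat (int m - (int k - int n)) = ?N - k" using that by auto
    with theta_term_Suc_a[of "int k - int n" m a b]
    have "?T (int k - int n) * (a * ?q ^ m) = ?T (int (Suc k) - int n) * ?q ^ (?N - k)"
      by (simp add: add_ac add_diff_eq)
    then have "?g ?N k * (?T (int k - int n) * (a * ?q ^ m))
        = ?g ?N k * (?T (int (Suc k) - int n) * ?q ^ (?N - k))"
      by (rule arg_cong)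
    then show ?thesis by (simp only: mult_ac)
  qed
  have "(\<Prod>j<Suc m. 1 + a * ?q ^ j) * (\<Prod>j<n. 1 + b * ?q ^ j)
     = (\<Sum>k\<le>?N. ?g ?N k * ?T (int k - int n)) * (1 + a * ?q ^ m)"
    using Suc.IH by (simp add: mult_ac)
  also have "\<dots> = (\<Sum>k\<le>?N. ?g ?N k * ?T (int k - int n))
      + (\<Sum>k\<le>?N. ?q ^ (?N - k) * ?g ?N k * ?T (int (Suc k) - int n))"
    unfolding distrib_left mult_1_right sum_distrib_right
      by (intro arg_cong2[where f = "(+)"] refl sum.cong) (simp only: atMost_iff *)
  also have "(\<Sum>k\<le>?N. ?g ?N k * ?T (int k - int n)) = (\<Sum>k\<le>Suc ?N. ?g ?N k * ?T (int k - int n))"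
    by simp
  also have "\<dots> = ?T (- int n) + (\<Sum>k\<le>?N. ?g ?N (Suc k) * ?T (int (Suc k) - int n))"
    by (subst sum.atMost_Suc_shift) simp
  also have "?T (- int n) + (\<Sum>k\<le>?N. ?g ?N (Suc k) * ?T (int (Suc k) - int n))
      + (\<Sum>k\<le>?N. ?q ^ (?N - k) * ?g ?N k * ?T (int (Suc k) - int n))
      = ?T (- int n) + (\<Sum>k\<le>?N. ?g (Suc ?N) (Suc k) * ?T (int (Suc k) - int n))"
    unfolding add.assoc sum.distrib[symmetric]
    by (intro arg_cong2[where f = "(+)"] refl sum.cong)
      (simp only: atMost_iff gauss_binomial_Suc_Suc' distrib_right add.commute)
  also have "\<dots> = (\<Sum>k\<le>Suc ?N. ?g (Suc ?N) k * ?T (int k - int n))"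
    by (subst sum.atMost_Suc_shift) simp
  finally show ?case by simp
qed

section \<open>Jacobi's triple product for formal power series\<close>

lemma fps_X_power_dvd_cancel_unit:
  fixes u f :: "'a :: idom fps"
  assumes "fps_X ^ M dvd u * f" "fps_nth u 0 \<noteq> 0"
  shows "fps_X ^ M dvd f"
proof (cases "f = 0")
  case False
  then have "M \<le> subdegree (u * f)"
    using assms by (intro subdegree_geI) (auto simp: fps_X_power_dvd_iff)
  also have "subdegree (u * f) = subdegree f"
    using False assms(2) by (subst subdegree_mult) auto
  finally show ?thesis using nth_less_subdegree_zero[of _ f] by (simp add: fps_X_power_dvd_iff)
qed simp

text \<open>
  Divisibility of a difference by \<open>q^M\<close> expresses that two series agree below degree \<open>M\<close>, in a
  form that is stable under the ring operations.
\<close>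
lemma qpoch_fps_X_power_cong:
  assumes "t > 0" "M \<le> i" "M \<le> j"
  shows "(fps_X :: int fps) ^ M dvd qpoch (fps_X ^ t) i - qpoch (fps_X ^ t) j"
proof -
  have ge: "(fps_X :: int fps) ^ M dvd qpoch (fps_X ^ t) i - qpoch (fps_X ^ t) M" if "M \<le> i" for i
    using that
  proof (induction i rule: dec_induct)
    case (step i)
    have "M \<le> t * Suc i" using step \<open>t > 0\<close> by (cases t) auto
    then have "(fps_X :: int fps) ^ M dvd qpoch (fps_X ^ t) i * fps_X ^ (t * Suc i)"
      by (intro dvd_mult le_imp_power_dvd)
    with step.IH have "(fps_X :: int fps) ^ M dvd
        (qpoch (fps_X ^ t) i - qpoch (fps_X ^ t) M) - qpoch (fps_X ^ t) i * fps_X ^ (t * Suc i)"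
      by (rule dvd_diff)
    then show ?case
      by (simp only: qpoch_Suc right_diff_distrib mult_1_right power_mult diff_diff_eq add.commute)
  qed simp
  from dvd_diff[OF ge[OF assms(2)] ge[OF assms(3)]] show ?thesis by simp
qed

lemma fps_nth_qpoch_0:
  assumes "t > 0"
  shows "fps_nth (qpoch (fps_X ^ t :: int fps) n) 0 = 1"
  using assms by (induction n) (simp_all add: qpoch_Suc fps_mult_nth)

text \<open>
  Away from the two ends, every Gaussian binomial coefficient tends to the inverse of the infinite
  product: in the factorial formula all three products agree below degree \<open>M\<close>, and one of them can
  be cancelled because it has constant term 1.
\<close>
lemma gauss_binomial_qpoch_cong_1:
  assumes "t > 0" "M \<le> n" "M \<le> k" "k + M \<le> 2 * n"
  shows "(fps_X :: int fps) ^ M dvd gauss_binomial (fps_X ^ t) (2 * n) k * qpoch (fps_X ^ t) n - 1"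
proof -
  define l where "l = 2 * n - k"
  let ?Q = "fps_X ^ t :: int fps" and ?d = "(fps_X :: int fps) ^ M"
  let ?g = "gauss_binomial ?Q (2 * n) k"
  have l: "k + l = 2 * n" "M \<le> l" using assms by (auto simp: l_def)
  have "qpoch ?Q k * (?g * qpoch ?Q l - 1) = qpoch ?Q (2 * n) - qpoch ?Q k"
    using gauss_binomial_qpoch[of ?Q k l] l by (simp add: algebra_simps)
  moreover have "?d dvd qpoch ?Q (2 * n) - qpoch ?Q k"
    by (rule qpoch_fps_X_power_cong) (use assms in auto)
  ultimately have "?d dvd qpoch ?Q k * (?g * qpoch ?Q l - 1)" by simp
  then have 1: "?d dvd ?g * qpoch ?Q l - 1"
    by (rule fps_X_power_dvd_cancel_unit) (use assms in \<open>simp add: fps_nth_qpoch_0\<close>)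
  have "?d dvd ?g * (qpoch ?Q n - qpoch ?Q l)"
    by (intro dvd_mult qpoch_fps_X_power_cong) (use assms l in auto)
  from dvd_add[OF this 1] show ?thesis by (simp add: algebra_simps)
qed

definition theta_exp :: "nat \<Rightarrow> nat \<Rightarrow> int \<Rightarrow> int" where
  "theta_exp r s k = int r * triangular k + int s * triangular (k - 1)"

text \<open>
  This is \<open>f(c q^r, c q^s)\<close> for a sign \<open>c\<close>; the sign of the term of index \<open>k\<close> is then \<open>c^(k\<^sup>2)\<close>.
  In the usual notation, \<open>theta 1 m m\<close> is \<open>\<phi>(q^m)\<close>, \<open>theta (-1) m m\<close> is \<open>\<phi>(-q^m)\<close>, and
  \<open>theta 1 m 0\<close> is \<open>2 \<psi>(q^m)\<close>, because \<open>k\<close> and \<open>-1 - k\<close> have the same triangular number.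
\<close>
definition theta :: "int \<Rightarrow> nat \<Rightarrow> nat \<Rightarrow> int fps" where
  "theta c r s = gen_fun UNIV (theta_exp r s) (\<lambda>k. c ^ nat (k\<^sup>2))"

lemma triangular_ge: "\<bar>k\<bar> - 1 \<le> triangular k" "\<bar>k\<bar> - 1 \<le> triangular (k - 1)"
proof -
  have "0 \<le> (\<bar>k\<bar> - 1) * (\<bar>k\<bar> - 2)"
    by (cases "\<bar>k\<bar> \<le> 1") (auto simp: mult_nonpos_nonpos)
  then have "3 * \<bar>k\<bar> - 2 \<le> k * k" by (simp add: algebra_simps abs_mult_self_eq)
  then show "\<bar>k\<bar> - 1 \<le> triangular k" "\<bar>k\<bar> - 1 \<le> triangular (k - 1)"
    using two_triangular[of k] two_triangular[of "k - 1"] by (auto simp: algebra_simps)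
qed

lemma theta_exp_nonneg [simp]: "0 \<le> theta_exp r s k"
  by (simp add: theta_exp_def)

text \<open>
  One of the two triangular numbers occurs with positive weight, and both are at least \<open>\<bar>k\<bar> - 1\<close>.
  This also covers \<open>s = 0\<close>, which is needed for \<open>\<psi>\<close>.
\<close>
lemma theta_exp_ge:
  assumes "r + s > 0"
  shows "\<bar>k\<bar> \<le> theta_exp r s k + 1"
proof (cases "r = 0")
  case True
  have "1 * triangular (k - 1) \<le> int s * triangular (k - 1)"
    by (rule mult_right_mono) (use assms True in auto)
  then show ?thesis using triangular_ge(2)[of k] True by (simp add: theta_exp_def)
next
  case False
  have "1 * triangular k \<le> int r * triangular k"
    by (rule mult_right_mono) (use False in auto)
  moreover have "0 \<le> int s * triangular (k - 1)" by simp
  ultimately show ?thesis using triangular_ge(1)[of k] unfolding theta_exp_def by linarith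
qed

lemma finite_below_theta_exp:
  assumes "r + s > 0"
  shows "finite_below UNIV (theta_exp r s)"
  unfolding finite_below_def
proof (intro conjI allI ballI)
  fix N
  have "{k \<in> UNIV. theta_exp r s k \<le> N} \<subseteq> {- (N + 1)..N + 1}"
  proof
    fix k assume "k \<in> {k \<in> UNIV. theta_exp r s k \<le> N}"
    then show "k \<in> {- (N + 1)..N + 1}" using theta_exp_ge[OF assms, of k] by (simp add: abs_le_iff)
  qed
  then show "finite {k \<in> UNIV. theta_exp r s k \<le> N}" by (rule finite_subset) simp
qed simp

lemma theta_term_fps:
  "theta_term (fps_const c * fps_X ^ r) (fps_const c * fps_X ^ s) k
    = fps_const (c ^ nat (k\<^sup>2)) * fps_X ^ nat (theta_exp r s k)"
proof -
  have "triangular k + triangular (k - 1) = k\<^sup>2"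
    using two_triangular[of k] two_triangular[of "k - 1"] by (simp add: power2_eq_square algebra_simps)
  then have "nat (k\<^sup>2) = nat (triangular k) + nat (triangular (k - 1))"
    by (metis nat_add_distrib triangular_nonneg)
  moreover have "nat (theta_exp r s k) = r * nat (triangular k) + s * nat (triangular (k - 1))"
    by (simp add: theta_exp_def nat_add_distrib nat_mult_distrib)
  ultimately show ?thesis
    by (simp add: theta_term_def power_mult_distrib power_add power_mult fps_const_power
        flip: fps_const_mult)
qed

text \<open>
  Multiplying the finite identity by \<open>(1 - Q) \<dots> (1 - Q^n)\<close> turns the coefficients of the theta
  terms of small index into 1 up to a high power of \<open>q\<close>, while the theta terms of large index are
  themselves divisible by a high power of \<open>q\<close>.
\<close>
theorem jacobi_triple_product:
  assumes c: "c * c = 1" and t: "r + s > 0"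
  shows "(\<lambda>n. \<Prod>j<n. (1 + fps_const c * fps_X ^ (r + (r + s) * j))
      * (1 + fps_const c * fps_X ^ (s + (r + s) * j))
           * (1 - fps_X ^ ((r + s) * Suc j))) \<longlonglongrightarrow> theta c r s"
proof (rule tendsto_fpsI, rule eventually_sequentiallyI)
  fix N n :: nat
  assume n: "2 * Suc N \<le> n"
  let ?a = "fps_const c * fps_X ^ r :: int fps" and ?b = "fps_const c * fps_X ^ s :: int fps"
  let ?Q = "fps_X ^ (r + s) :: int fps" and ?d = "(fps_X :: int fps) ^ Suc N"
  let ?e = "theta_exp r s"
  define T where "T k = theta_term ?a ?b (int k - int n)" for k
  define g where "g k = gauss_binomial ?Q (2 * n) k" for k
  have Q: "?a * ?b = ?Q"
    using c by (simp add: power_add mult_ac)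
  have "(\<Prod>j<n. (1 + fps_const c * fps_X ^ (r + (r + s) * j))
      * (1 + fps_const c * fps_X ^ (s + (r + s) * j))
           * (1 - fps_X ^ ((r + s) * Suc j)))
     = (\<Prod>j<n. 1 + ?a * ?Q ^ j) * (\<Prod>j<n. 1 + ?b * ?Q ^ j) * qpoch ?Q n" (is "?P = _")
    by (simp only: qpoch_def prod.distrib power_add power_mult mult.assoc)
  also have "\<dots> = (\<Sum>k\<le>2 * n. g k * T k) * qpoch ?Q n"
    using finite_jacobi_triple_product[of ?a ?b n n] by (simp only: Q T_def g_def mult_2)
  also have "\<dots> = (\<Sum>k\<le>2 * n. (g k * qpoch ?Q n) * T k)"
    unfolding sum_distrib_right by (simp only: mult_ac)
  finally have P: "?P - (\<Sum>k\<le>2 * n. T k) = (\<Sum>k\<le>2 * n. (g k * qpoch ?Q n - 1) * T k)"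
    by (simp add: sum_subtractf algebra_simps)
  have "?d dvd (g k * qpoch ?Q n - 1) * T k" if k: "k \<le> 2 * n" for k
  proof (cases "Suc N \<le> k \<and> k + Suc N \<le> 2 * n")
    case True
    then show ?thesis
      unfolding g_def using gauss_binomial_qpoch_cong_1[OF t, of "Suc N" n k] n
          by (intro dvd_mult2) auto
  next
    case False
    then have "k + (N + 2) \<le> n \<or> n + (N + 2) \<le> k" using n by presburger
    then have "int N + 2 \<le> \<bar>int k - int n\<bar>" by linarith
    also have "\<dots> \<le> ?e (int k - int n) + 1" by (rule theta_exp_ge[OF t])
    finally have "Suc N \<le> nat (?e (int k - int n))" by linarith
    then show ?thesis
      unfolding T_def theta_term_fps by (intro dvd_mult le_imp_power_dvd)
  qed
  then have "?d dvd ?P - (\<Sum>k\<le>2 * n. T k)" unfolding P by (intro dvd_sum) auto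
  then have "fps_nth ?P N = fps_nth (\<Sum>k\<le>2 * n. T k) N"
    by (simp add: fps_X_power_dvd_iff del: power_Suc)
  also have "\<dots> = (\<Sum>k\<le>2 * n. if ?e (int k - int n) = int N then c ^ nat ((int k - int n)\<^sup>2) else 0)"
    unfolding fps_sum_nth T_def theta_term_fps
    by (intro sum.cong) (auto simp: fps_X_power_nth)
  also have "\<dots> = (\<Sum>k\<in>{- int n..int n}. if ?e k = int N then c ^ nat (k\<^sup>2) else 0)"
    by (rule sum.reindex_bij_witness[of _ "\<lambda>k. nat (k + int n)" "\<lambda>k. int k - int n"]) auto
  also have "\<dots> = (\<Sum>k | k \<in> {- int n..int n} \<and> ?e k = int N. c ^ nat (k\<^sup>2))"
    by (rule sum.inter_filter[symmetric]) simp
  also have "{k. k \<in> {- int n..int n} \<and> ?e k = int N} = {k. k \<in> UNIV \<and> ?e k = int N}"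
  proof -
    have "int N + 1 \<le> int n" using n by simp
    then have "\<bar>k\<bar> \<le> int n" if "?e k = int N" for k using theta_exp_ge[OF t, of k] that by linarith
    then show ?thesis by (auto simp: abs_le_iff minus_le_iff)
  qed
  finally show "fps_nth ?P N = fps_nth (theta c r s) N"
    by (simp add: theta_def gen_fun_def)
qed

section \<open>Theta functions as Euler products\<close>

lemma tendsto_qpoch_euler_prod:
  assumes "m > 0" "filterlim g sequentially sequentially"
  shows "(\<lambda>n. qpoch (fps_X ^ m) (g n)) \<longlonglongrightarrow> euler_prod m"
proof -
  have "(\<lambda>n. qpoch (fps_X ^ m) n) \<longlonglongrightarrow> euler_prod m"
    using has_prod_imp_tendsto'[OF euler_prod_has_prod[OF assms(1)]]
    by (simp only: qpoch_def power_mult)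
  then show ?thesis using assms(2) by (rule filterlim_compose)
qed

lemma filterlim_mult_sequentially: "c > 0
    \<Longrightarrow> filterlim (\<lambda>n. c * n) sequentially (sequentially :: nat filter)"
  by (rule filterlim_subseq) (simp add: strict_mono_def)

lemma qpoch_2: "qpoch Q (2 * n) = (\<Prod>j<n. (1 - Q ^ Suc (2 * j)) * (1 - Q ^ Suc (Suc (2 * j))))"
  by (induction n) (simp_all add: qpoch_Suc mult_ac)

lemma qpoch_3:
  "qpoch Q (3 * n) = (\<Prod>j<n. (1 - Q ^ Suc (3 * j)) * (1 - Q ^ Suc (Suc (3 * j)))
      * (1 - Q ^ Suc (Suc (Suc (3 * j)))))"
proof (induction n)
  case (Suc n)
  have "3 * Suc n = Suc (Suc (Suc (3 * n)))" by simp
  then show ?case using Suc by (simp only: qpoch_Suc prod.lessThan_Suc mult.assoc)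
qed simp

text \<open>
  The finite form of Gauss's product for \<open>2 \<psi>\<close>. Each side factor pairs with a conjugate via
  \<open>(1 + z) (1 - z) = 1 - z\<^sup>2\<close>, except the factor \<open>1 + Y^0 = 2\<close>.
\<close>
lemma qpoch_psi:
  fixes Y :: "'a :: comm_ring_1"
  shows "(\<Prod>j<Suc n. (1 + Y ^ Suc j) * (1 + Y ^ j) * (1 - Y ^ Suc j)) * qpoch Y n
     = 2 * qpoch (Y ^ 2) (Suc n) * qpoch (Y ^ 2) n"
proof (induction n)
  case 0
  show ?case by (simp add: qpoch_Suc algebra_simps power2_eq_square)
next
  case (Suc n)
  let ?J = "\<lambda>n. \<Prod>j<n. (1 + Y ^ Suc j) * (1 + Y ^ j) * (1 - Y ^ Suc j)"
  let ?u = "Y ^ Suc (Suc n)" and ?v = "Y ^ Suc n"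
  have double: "(1 + z) * (1 - z) = 1 - z ^ 2" for z :: 'a
    by (simp add: algebra_simps power2_eq_square)
  have "?J (Suc (Suc n)) * qpoch Y (Suc n)
    = (?J (Suc n) * qpoch Y n) * (((1 + ?u) * (1 - ?u)) * ((1 + ?v) * (1 - ?v)))"
    by (simp only: prod.lessThan_Suc[of _ "Suc n"] qpoch_Suc mult_ac)
  also have "\<dots> = 2 * qpoch (Y ^ 2) (Suc n) * qpoch (Y ^ 2) n
      * ((1 - (Y ^ 2) ^ Suc (Suc n)) * (1 - (Y ^ 2) ^ Suc n))"
    unfolding Suc.IH double by (simp only: power_mult[symmetric] mult.commute)
  also have "\<dots> = 2 * qpoch (Y ^ 2) (Suc (Suc n)) * qpoch (Y ^ 2) (Suc n)"
    by (simp only: qpoch_Suc mult_ac)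
  finally show ?case .
qed

lemma one_plus_minus_fps_X_power: "1 + fps_const (-1) * fps_X ^ k = (1 - fps_X ^ k :: int fps)"
  by (simp flip: fps_const_neg)

text \<open>
  Euler's pentagonal number theorem: the three kinds of factors run through the three residue
  classes modulo 3.
\<close>
lemma theta_eq_euler_prod:
  assumes "m > 0"
  shows "theta (-1) m (2 * m) = euler_prod m"
proof (rule LIMSEQ_unique)
  have e: "m + (m + 2 * m) * j = m * Suc (3 * j)" "2 * m + (m + 2 * m) * j = m * Suc (Suc (3 * j))"
    "(m + 2 * m) * Suc j = m * Suc (Suc (Suc (3 * j)))" for j by (simp_all add: algebra_simps)
  have "(\<lambda>n. \<Prod>j<n. (1 - fps_X ^ (m * Suc (3 * j))) * (1 - fps_X ^ (m * Suc (Suc (3 * j)))) *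
      (1 - fps_X ^ (m * Suc (Suc (Suc (3 * j)))))) \<longlonglongrightarrow> theta (-1) m (2 * m)"
    using jacobi_triple_product[of "-1" m "2 * m"] assms
    unfolding one_plus_minus_fps_X_power e by simp
  then show "(\<lambda>n. qpoch (fps_X ^ m) (3 * n)) \<longlonglongrightarrow> theta (-1) m (2 * m)"
    unfolding qpoch_3 power_mult[symmetric] .
  show "(\<lambda>n. qpoch (fps_X ^ m) (3 * n)) \<longlonglongrightarrow> euler_prod m"
    by (rule tendsto_qpoch_euler_prod[OF assms filterlim_mult_sequentially]) simp
qed

text \<open>
  Gauss's product \<open>\<phi>(-q) = f\<^sub>1\<^sup>2 / f\<^sub>2\<close>: the odd exponents occur twice in the triple product and
  the even ones once, so a further factor \<open>f\<^sub>2\<close> completes the square.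
\<close>
lemma theta_phi_minus_eq_euler_prod:
  assumes "m > 0"
  shows "theta (-1) m m * euler_prod (2 * m) = euler_prod m ^ 2"
proof (rule LIMSEQ_unique)
  let ?J = "\<lambda>n. \<Prod>j<n. (1 - fps_X ^ (m * Suc (2 * j))) * (1 - fps_X ^ (m * Suc (2 * j)))
      * (1 - fps_X ^ (2 * m * Suc j)) :: int fps"
  have e: "m + (m + m) * j = m * Suc (2 * j)" "(m + m) * Suc j = 2 * m * Suc j" for j
    by (simp_all add: algebra_simps)
  have "?J \<longlonglongrightarrow> theta (-1) m m"
    using jacobi_triple_product[of "-1" m m] assms
    unfolding one_plus_minus_fps_X_power e by simp
  from tendsto_fps_mult[OF this tendsto_qpoch_euler_prod[of "2 * m" "\<lambda>n. n"]] assms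
  show "(\<lambda>n. ?J n * qpoch (fps_X ^ (2 * m)) n) \<longlonglongrightarrow> theta (-1) m m * euler_prod (2 * m)"
    by (simp add: filterlim_ident)
  have e': "m * Suc (Suc (2 * j)) = 2 * m * Suc j" for j by simp
  have "?J n * qpoch (fps_X ^ (2 * m)) n = qpoch (fps_X ^ m) (2 * n) * qpoch (fps_X ^ m) (2 * n)" for n
    unfolding qpoch_2 qpoch_def[of "fps_X ^ (2 * m)"] power_mult[symmetric] e' prod.distrib
        by (simp only: mult_ac)
  moreover have "(\<lambda>n. qpoch (fps_X ^ m) (2 * n) * qpoch (fps_X ^ m) (2 * n))
      \<longlonglongrightarrow> euler_prod m * euler_prod m"
    by (intro tendsto_fps_mult tendsto_qpoch_euler_prod[OF assms filterlim_mult_sequentially]) simp_all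
  ultimately show "(\<lambda>n. ?J n * qpoch (fps_X ^ (2 * m)) n) \<longlonglongrightarrow> euler_prod m ^ 2"
    by (simp add: power2_eq_square)
qed

text \<open>
  Gauss's product \<open>\<psi>(q) = f\<^sub>2\<^sup>2 / f\<^sub>1\<close>. The factor 2 is the factor \<open>1 + q^0\<close> of the triple
  product.
\<close>
lemma theta_psi_eq_euler_prod:
  assumes "m > 0"
  shows "theta 1 m 0 * euler_prod m = 2 * euler_prod (2 * m) ^ 2"
proof (rule LIMSEQ_unique)
  let ?Y = "fps_X ^ m :: int fps"
  let ?J = "\<lambda>n. \<Prod>j<n. (1 + ?Y ^ Suc j) * (1 + ?Y ^ j) * (1 - ?Y ^ Suc j)"
  have e: "m + (m + 0) * j = m * Suc j" "0 + (m + 0) * j = m * j" "(m + 0) * Suc j = m * Suc j" for j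
    by (simp_all add: algebra_simps)
  have "?J \<longlonglongrightarrow> theta 1 m 0"
    using jacobi_triple_product[of 1 m 0] assms
    unfolding e fps_const_1_eq_1 mult_1_left power_mult by simp
  then have "(\<lambda>n. ?J (Suc n)) \<longlonglongrightarrow> theta 1 m 0" by (rule LIMSEQ_Suc)
  from tendsto_fps_mult[OF this tendsto_qpoch_euler_prod[OF assms filterlim_ident]]
  have "(\<lambda>n. ?J (Suc n) * qpoch ?Y n) \<longlonglongrightarrow> theta 1 m 0 * euler_prod m" .
  then show "(\<lambda>n. 2 * qpoch (?Y ^ 2) (Suc n) * qpoch (?Y ^ 2) n) \<longlonglongrightarrow> theta 1 m 0 * euler_prod m"
    unfolding qpoch_psi .
  have Y: "?Y ^ 2 = fps_X ^ (2 * m)" by (simp only: mult.commute[of 2] power_mult)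
  have "(\<lambda>n. 2 * qpoch (?Y ^ 2) (Suc n) * qpoch (?Y ^ 2) n)
      \<longlonglongrightarrow> 2 * euler_prod (2 * m) * euler_prod (2 * m)"
    unfolding Y using assms
    by (intro tendsto_fps_mult tendsto_const tendsto_qpoch_euler_prod filterlim_Suc filterlim_ident)
        auto
  then show "(\<lambda>n. 2 * qpoch (?Y ^ 2) (Suc n) * qpoch (?Y ^ 2) n) \<longlonglongrightarrow> 2 * euler_prod (2 * m) ^ 2"
    by (simp only: power2_eq_square mult.assoc)
qed

section \<open>Quadratic relations between theta functions\<close>

lemma minus_one_power_square: "(-1 :: int) ^ nat (k\<^sup>2) = (if even k then 1 else -1)"
  by (simp add: minus_one_power_iff even_nat_iff)

lemma theta_compose_X_power:
  assumes "d > 0"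
  shows "theta c r s oo fps_X ^ d = theta c (d * r) (d * s)"
  unfolding theta_def gen_fun_compose_X_power[OF assms]
  by (rule gen_fun_cong) (simp_all add: theta_exp_def algebra_simps)

lemma two_theta_exp: "2 * theta_exp r s k = int r * (k * (k + 1)) + int s * (k * (k - 1))"
proof -
  have "2 * theta_exp r s k = int r * (2 * triangular k) + int s * (2 * triangular (k - 1))"
    by (simp add: theta_exp_def algebra_simps)
  then show ?thesis unfolding two_triangular by (simp add: algebra_simps)
qed

lemma gen_fun_split_parity:
  assumes "finite_below UNIV e"
  shows "gen_fun UNIV e s = gen_fun {(x, y). even (x + y)} e s
      + gen_fun {(x, y). odd (x + y :: int)} e s"
proof -
  have "{(x, y). even (x + y)} \<union> {(x, y). odd (x + y :: int)} = UNIV" by auto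
  moreover have "{(x, y). even (x + y)} \<inter> {(x, y). odd (x + y :: int)} = {}" by auto
  ultimately show ?thesis using gen_fun_Un[of "{(x, y). even (x + y)}"
        "{(x, y). odd (x + y)}" e s] assms
    by simp
qed

text \<open>
  The pairs with even coordinate sum form a lattice similar to \<open>\<int>\<^sup>2\<close>, and those with odd sum are a
  translate of it. This is the source of the duplication formulas for \<open>\<phi>\<close> and \<open>\<psi>\<close>.
\<close>
lemma bij_betw_even_lattice:
  "bij_betw (\<lambda>(u, v). (u + v, u - v)) UNIV {(x, y :: int). even (x + y)}"
  by (rule bij_betw_byWitness[where f' = "\<lambda>(x, y). ((x + y) div 2, (x + y) div 2 - y)"])
    (auto elim!: evenE simp: algebra_simps)

lemma bij_betw_odd_lattice:
  "bij_betw (\<lambda>(u, v). (u + v + 1, u - v)) UNIV {(x, y :: int). odd (x + y)}"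
  by (rule bij_betw_byWitness[where f' = "\<lambda>(x, y). ((x + y - 1) div 2, (x - y - 1) div 2)"])
    (auto elim!: oddE simp: algebra_simps)

text \<open>
  A second parametrization of the odd class, composed with the reflection \<open>y \<mapsto> -1 - y\<close>, which
  preserves triangular numbers and exchanges the two parity classes.
\<close>
lemma bij_betw_odd_lattice_reflected:
  "bij_betw (\<lambda>(u, v). (u + v, v - u - 1)) UNIV {(x, y :: int). odd (x + y)}"
  by (rule bij_betw_byWitness[where f' = "\<lambda>(x, y). ((x - y - 1) div 2, (x + y + 1) div 2)"])
    (auto elim!: oddE simp: algebra_simps)

lemma finite_below_theta_exp_add:
  assumes "r + s > 0" "r' + s' > 0"
  shows "finite_below UNIV (\<lambda>(x, y). theta_exp r s x + theta_exp r' s' y)"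
  using finite_below_Times[OF finite_below_theta_exp[OF assms(1)] finite_below_theta_exp[OF assms(2)]]
  by simp

lemma theta_mult:
  assumes "r + s > 0" "r' + s' > 0"
  shows "theta c r s * theta c' r' s' = gen_fun UNIV (\<lambda>(x, y). theta_exp r s x + theta_exp r' s' y)
     (\<lambda>(x, y). c ^ nat (x\<^sup>2) * c' ^ nat (y\<^sup>2))"
  using gen_fun_mult[OF finite_below_theta_exp[OF assms(1)] finite_below_theta_exp[OF assms(2)]]
  by (simp add: theta_def)

text \<open>
  The dissection \<open>\<phi>(-q)\<^sup>2 = \<phi>(q\<^sup>2)\<^sup>2 - 4 q \<psi>(q\<^sup>4)\<^sup>2\<close>: pairs with even coordinate sum give the
  first term, pairs with odd sum the second.
\<close>
lemma theta_phi_minus_square: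
  assumes "m > 0"
  shows "theta (-1) m m ^ 2 = theta 1 (2 * m) (2 * m) ^ 2 - fps_X ^ m * theta 1 (4 * m) 0 ^ 2"
proof -
  let ?e = "\<lambda>(x, y). theta_exp m m x + theta_exp m m y"
  let ?s = "\<lambda>(x, y). (-1) ^ nat (x\<^sup>2) * (-1) ^ nat (y\<^sup>2) :: int"
  have "theta (-1) m m ^ 2 = gen_fun {(x, y). even (x + y)} ?e ?s + gen_fun {(x, y). odd (x + y)} ?e ?s"
    using theta_mult[of m m m m "-1" "-1"]
        gen_fun_split_parity[OF finite_below_theta_exp_add[of m m m m], of ?s] assms
    by (simp add: power2_eq_square)
  moreover have "gen_fun {(x, y). even (x + y)} ?e ?s = theta 1 (2 * m) (2 * m) ^ 2"
  proof -
    have e: "theta_exp m m (u + v) + theta_exp m m (u - v)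
        = theta_exp (2 * m) (2 * m) u + theta_exp (2 * m) (2 * m) v" for u v
    proof -
      have "2 * (theta_exp m m (u + v) + theta_exp m m (u - v))
          = 2 * (theta_exp (2 * m) (2 * m) u + theta_exp (2 * m) (2 * m) v)"
        unfolding distrib_left two_theta_exp by (simp add: algebra_simps)
      then show ?thesis by simp
    qed
    show ?thesis
      using assms
      by (simp only: power2_eq_square theta_mult, intro
          gen_fun_bij[OF bij_betw_even_lattice, symmetric])
        (auto simp: e minus_one_power_square simp flip: power2_eq_square)
  qed
  moreover have "gen_fun {(x, y). odd (x + y)} ?e ?s = - (fps_X ^ m * theta 1 (4 * m) 0 ^ 2)"
  proof -
    have e: "theta_exp m m (u + v + 1) + theta_exp m m (u - v)
        = theta_exp (4 * m) 0 u + theta_exp (4 * m) 0 v + int m" for u v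
    proof -
      have "2 * (theta_exp m m (u + v + 1) + theta_exp m m (u - v))
          = 2 * (theta_exp (4 * m) 0 u + theta_exp (4 * m) 0 v + int m)"
        unfolding distrib_left two_theta_exp by (simp add: algebra_simps)
      then show ?thesis by simp
    qed
    have "theta 1 (4 * m) 0 ^ 2 = gen_fun UNIV (\<lambda>(x, y). theta_exp (4 * m) 0 x
        + theta_exp (4 * m) 0 y) (\<lambda>_. 1)"
      and fin: "finite_below UNIV (\<lambda>(x, y). theta_exp (4 * m) 0 x + theta_exp (4 * m) 0 y)"
      using theta_mult[of "4 * m" 0 "4 * m" 0 1 1]
          finite_below_theta_exp_add[of "4 * m" 0 "4 * m" 0] assms
    by (simp_all add: power2_eq_square split_def)
    then have "- (fps_X ^ m * theta 1 (4 * m) 0 ^ 2) =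
      gen_fun UNIV (\<lambda>p. (case p of (x, y) \<Rightarrow> theta_exp (4 * m) 0 x + theta_exp (4 * m) 0 y) + int m)
          (\<lambda>_. - 1)"
      by (simp add: gen_fun_shift flip: gen_fun_uminus)
    also have "\<dots> = gen_fun {(x, y). odd (x + y)} ?e ?s"
      by (rule gen_fun_bij[OF bij_betw_odd_lattice]) (auto simp: e minus_one_power_square)
    finally show ?thesis ..
  qed
  ultimately show ?thesis by simp
qed

text \<open>
  The relation \<open>\<psi>(q)\<^sup>2 = \<phi>(q) \<psi>(q\<^sup>2)\<close>. Here both parity classes contribute the same series.
\<close>
lemma theta_psi_square:
  assumes "m > 0"
  shows "theta 1 m 0 ^ 2 = 2 * (theta 1 m m * theta 1 (2 * m) 0)"
proof -
  let ?e = "\<lambda>(x, y). theta_exp m 0 x + theta_exp m 0 y"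
  let ?e' = "\<lambda>(x, y). theta_exp m m x + theta_exp (2 * m) 0 y"
  have r: "theta 1 m m * theta 1 (2 * m) 0 = gen_fun UNIV ?e' (\<lambda>_. 1)"
    using theta_mult[of m m "2 * m" 0 1 1] assms by (simp add: split_def)
  have "theta 1 m 0 ^ 2 = gen_fun UNIV ?e (\<lambda>_. 1)" and "finite_below UNIV ?e"
    using theta_mult[of m 0 m 0 1 1] finite_below_theta_exp_add[of m 0 m 0] assms
    by (simp_all add: power2_eq_square split_def)
  then have "theta 1 m 0 ^ 2 = gen_fun {(x, y). even (x + y)} ?e (\<lambda>_. 1)
      + gen_fun {(x, y). odd (x + y)} ?e (\<lambda>_. 1)"
    using gen_fun_split_parity by simp
  moreover have "gen_fun UNIV ?e' (\<lambda>_. 1) = gen_fun {(x, y). even (x + y)} ?e (\<lambda>_. 1)"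
  proof (rule gen_fun_bij[where h = "\<lambda>(v, u). (u + v, u - v)"])
    have "bij_betw (\<lambda>(v, u). (u, v)) (UNIV :: (int \<times> int) set) UNIV"
      by (rule bij_betw_byWitness[where f' = "\<lambda>(u, v). (v, u)"]) auto
    from bij_betw_trans[OF this bij_betw_even_lattice]
    show "bij_betw (\<lambda>(v, u). (u + v, u - v)) UNIV {(x, y :: int). even (x + y)}"
      by (simp add: comp_def split_def)
    fix p :: "int \<times> int"
    obtain v u where p: "p = (v, u)" by force
    have "2 * (theta_exp m 0 (u + v) + theta_exp m 0 (u - v))
        = 2 * (theta_exp m m v + theta_exp (2 * m) 0 u)"
      unfolding distrib_left two_theta_exp by (simp add: algebra_simps)
    then show "?e (case p of (v, u) \<Rightarrow> (u + v, u - v)) = ?e' p" by (simp add: p)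
  qed simp
  moreover have "gen_fun UNIV ?e' (\<lambda>_. 1) = gen_fun {(x, y). odd (x + y)} ?e (\<lambda>_. 1)"
  proof (rule gen_fun_bij[where h = "\<lambda>(v, u). (u + v, v - u - 1)"])
    have "bij_betw (\<lambda>(v, u). (u, v)) (UNIV :: (int \<times> int) set) UNIV"
      by (rule bij_betw_byWitness[where f' = "\<lambda>(u, v). (v, u)"]) auto
    from bij_betw_trans[OF this bij_betw_odd_lattice_reflected]
    show "bij_betw (\<lambda>(v, u). (u + v, v - u - 1)) UNIV {(x, y :: int). odd (x + y)}"
      by (simp add: comp_def split_def)
    fix p :: "int \<times> int"
    obtain v u where p: "p = (v, u)" by force
    have "2 * (theta_exp m 0 (u + v) + theta_exp m 0 (v - u - 1))
        = 2 * (theta_exp m m v + theta_exp (2 * m) 0 u)"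
      unfolding distrib_left two_theta_exp by (simp add: algebra_simps)
    then show "?e (case p of (v, u) \<Rightarrow> (u + v, v - u - 1)) = ?e' p" by (simp add: p)
  qed simp
  ultimately show ?thesis by (simp add: r)
qed

section \<open>The norm form \<open>x\<^sup>2 + 5 y\<^sup>2\<close>\<close>

definition odd_lattice :: "(int \<times> int) set" where
  "odd_lattice = {(x, y). odd (x + y)}"

text \<open>
  On the pairs of opposite parity, \<open>x\<^sup>2 + 5 y\<^sup>2\<close> is congruent to 1 modulo 4, so the division is
  exact.
\<close>
definition norm_exp :: "int \<times> int \<Rightarrow> int" where
  "norm_exp = (\<lambda>(x, y). (x\<^sup>2 + 5 * y\<^sup>2 - 1) div 4)"

definition norm_sign :: "int \<times> int \<Rightarrow> int" where
  "norm_sign = (\<lambda>(x, y). if even y then 1 else -1)"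

lemma norm_exp_eqI: "x\<^sup>2 + 5 * y\<^sup>2 = 4 * t + 1 \<Longrightarrow> norm_exp (x, y) = t"
  by (simp add: norm_exp_def)

lemma finite_below_norm_exp: "finite_below odd_lattice norm_exp"
  unfolding finite_below_def
proof (intro conjI allI ballI)
  fix p assume "p \<in> odd_lattice"
  then obtain x y where p: "p = (x, y)" "x \<noteq> 0 \<or> y \<noteq> 0" by (auto simp: odd_lattice_def)
  then have "x\<^sup>2 \<ge> 1 \<or> y\<^sup>2 \<ge> 1" using zero_less_power2[of x] zero_less_power2[of y] by linarith
  then have "x\<^sup>2 + 5 * y\<^sup>2 - 1 \<ge> 0" using zero_le_power2[of x] zero_le_power2[of y] by linarith
  then show "0 \<le> norm_exp p" by (simp add: norm_exp_def p)
next
  fix N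
  have abs_le: "\<bar>x\<bar> \<le> x\<^sup>2" for x :: int
    by (cases "x = 0") (use self_le_power[of "\<bar>x\<bar>" 2] in auto)
  have "{p \<in> odd_lattice. norm_exp p \<le> N} \<subseteq> {-(4 * N + 4)..4 * N + 4} \<times> {-(4 * N + 4)..4 * N + 4}"
  proof
    fix p assume "p \<in> {p \<in> odd_lattice. norm_exp p \<le> N}"
    then obtain x y where p: "p = (x, y)" and "norm_exp (x, y) \<le> N" by (cases p) auto
    then have "x\<^sup>2 + 5 * y\<^sup>2 \<le> 4 * N + 4" unfolding norm_exp_def by simp
    then have "\<bar>x\<bar> \<le> 4 * N + 4" "\<bar>y\<bar> \<le> 4 * N + 4"
      using abs_le[of x] abs_le[of y] zero_le_power2[of x] zero_le_power2[of y] by linarith+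
    then show "p \<in> {-(4 * N + 4)..4 * N + 4} \<times> {-(4 * N + 4)..4 * N + 4}"
      by (auto simp: p abs_le_iff)
  qed
  then show "finite {p \<in> odd_lattice. norm_exp p \<le> N}" by (rule finite_subset) simp
qed

text \<open>
  Sorting the pairs by which coordinate is odd splits the signed sum over the form \<open>x\<^sup>2 + 5 y\<^sup>2\<close>
  into two products of theta functions.
\<close>
lemma odd_lattice_theta:
  "gen_fun odd_lattice norm_exp norm_sign
      = theta 1 2 0 * theta 1 5 5 - fps_X * (theta 1 1 1 * theta 1 10 0)"
proof -
  let ?E = "{(x :: int, y :: int). odd x \<and> even y}" and ?O = "{(x :: int, y :: int). even x \<and> odd y}"
  have L: "odd_lattice = ?E \<union> ?O" "?E \<inter> ?O = {}" by (auto simp: odd_lattice_def)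
  have "gen_fun odd_lattice norm_exp norm_sign
      = gen_fun ?E norm_exp norm_sign + gen_fun ?O norm_exp norm_sign"
    using gen_fun_Un[OF _ L(2)] finite_below_norm_exp unfolding L(1) by blast
  moreover have "gen_fun ?E norm_exp norm_sign = theta 1 2 0 * theta 1 5 5"
  proof -
    have "bij_betw (\<lambda>(k, l). (2 * k + 1, 2 * l)) UNIV ?E"
      by (rule bij_betw_byWitness[where f' = "\<lambda>(x, y). (x div 2, y div 2)"])
          (auto simp: odd_two_times_div_two_succ)
    moreover have "norm_exp (2 * k + 1, 2 * l) = theta_exp 2 0 k + theta_exp 5 5 l" for k l
      using two_theta_exp[of 2 0 k] two_theta_exp[of 5 5 l]
      by (intro norm_exp_eqI) (simp add: power2_eq_square algebra_simps)
    ultimately have "gen_fun UNIV (\<lambda>(k, l). theta_exp 2 0 k + theta_exp 5 5 l) (\<lambda>_. 1)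
        = gen_fun ?E norm_exp norm_sign"
      by (intro gen_fun_bij) (auto simp: norm_sign_def)
    then show ?thesis using theta_mult[of 2 0 5 5 1 1] by (simp add: split_def)
  qed
  moreover have "gen_fun ?O norm_exp norm_sign = - (fps_X * (theta 1 1 1 * theta 1 10 0))"
  proof -
    let ?f = "\<lambda>(k, l). theta_exp 1 1 k + theta_exp 10 0 l"
    have "theta 1 1 1 * theta 1 10 0 = gen_fun UNIV ?f (\<lambda>_. 1)"
      using theta_mult[of 1 1 10 0 1 1] by (simp add: split_def)
    then have "- (fps_X * (theta 1 1 1 * theta 1 10 0)) = gen_fun UNIV (\<lambda>p. ?f p + int 1) (\<lambda>_. - 1)"
      using gen_fun_shift[OF finite_below_theta_exp_add[of 1 1 10 0], of 1 "\<lambda>_. 1"]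
          by (simp flip: gen_fun_uminus)
    also have "\<dots> = gen_fun ?O norm_exp norm_sign"
    proof (rule gen_fun_bij)
      show "bij_betw (\<lambda>(k, l). (2 * k, 2 * l + 1)) UNIV ?O"
        by (rule bij_betw_byWitness[where f' = "\<lambda>(x, y). (x div 2, y div 2)"])
            (auto simp: odd_two_times_div_two_succ)
      have "norm_exp (2 * k, 2 * l + 1) = theta_exp 1 1 k + theta_exp 10 0 l + 1" for k l
        using two_theta_exp[of 1 1 k] two_theta_exp[of 10 0 l]
        by (intro norm_exp_eqI) (simp add: power2_eq_square algebra_simps)
      then show "norm_exp (case p of (k, l) \<Rightarrow> (2 * k, 2 * l + 1)) = ?f p + int 1" for p
        by (auto split: prod.split)
    qed (auto simp: norm_sign_def)
    finally show ?thesis ..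
  qed
  ultimately show ?thesis by simp
qed

text \<open>
  The same signed sum, sorted by \<open>x + y\<close> modulo 6. By the pentagonal number theorem \<open>f\<^sub>1 f\<^sub>5\<close> is a
  sum over \<open>u\<^sup>2 + 5 v\<^sup>2 = 6 (4 N + 1)\<close> with \<open>u = 6 m - 1\<close>, \<open>v = 6 n - 1\<close>. Dividing \<open>u + v \<surd>(-5)\<close>
  by the element \<open>1 + \<surd>(-5)\<close> of norm 6 gives the pair \<open>(x, y) = (m + 5 n - 1, n - m)\<close>, with
  \<open>x + y = 6 n - 1\<close>. So the class \<open>-1\<close> yields \<open>f\<^sub>1 f\<^sub>5\<close>, the class 1 yields it again by negation,
  and the class 3 cancels against itself under an isometry that changes the parity of \<open>y\<close>.
\<close>
lemma odd_lattice_euler_prod: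
  "gen_fun odd_lattice norm_exp norm_sign = 2 * (euler_prod 1 * euler_prod 5)"
proof -
  define L where "L r = {(x :: int, y :: int). (x + y) mod 6 = r}" for r
  let ?G = "\<lambda>r. gen_fun (L r) norm_exp norm_sign"
  have L: "odd_lattice = L 5 \<union> (L 1 \<union> L 3)"
  proof -
    have "odd t \<longleftrightarrow> t mod 6 = 5 \<or> t mod 6 = 1 \<or> t mod 6 = 3" for t :: int
      by presburger
    then have "odd_lattice = {(x, y). (x + y) mod 6 = 5 \<or> (x + y) mod 6 = 1 \<or> (x + y) mod 6 = 3}"
      unfolding odd_lattice_def by (simp only:)
    then show ?thesis unfolding L_def by auto
  qed
  have "L 5 \<inter> (L 1 \<union> L 3) = {}" "L 1 \<inter> L 3 = {}" by (auto simp: L_def)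
  then have "gen_fun odd_lattice norm_exp norm_sign = ?G 5 + (?G 1 + ?G 3)"
    using finite_below_norm_exp finite_below_subset[OF finite_below_norm_exp, of "L 1 \<union> L 3"]
    unfolding L by (simp add: gen_fun_Un)
  moreover have "?G 5 = euler_prod 1 * euler_prod 5"
  proof -
    have "gen_fun UNIV (\<lambda>(m, n). theta_exp 1 2 m + theta_exp 5 10 n)
        (\<lambda>(m, n). (-1) ^ nat (m\<^sup>2) * (-1) ^ nat (n\<^sup>2)) = ?G 5"
    proof (rule gen_fun_bij)
      have "x + y + 1 = 6 * ((x + y + 1) div 6)" if "(x + y) mod 6 = 5" for x y :: int
        using that by presburger
      moreover have "(6 * n - 1) mod 6 = 5" for n :: int by presburger
      ultimately show "bij_betw (\<lambda>(m, n). (m + 5 * n - 1, n - m)) UNIV (L 5)"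
        by (intro bij_betw_byWitness[where f' = "\<lambda>(x, y). ((x + y + 1) div 6 - y, (x + y + 1) div 6)"])
          (auto simp: L_def)
      have "norm_exp (m + 5 * n - 1, n - m) = theta_exp 1 2 m + theta_exp 5 10 n" for m n
        using two_theta_exp[of 1 2 m] two_theta_exp[of 5 10 n]
        by (intro norm_exp_eqI) (simp add: power2_eq_square algebra_simps)
      then show "norm_exp (case p of (m, n) \<Rightarrow> (m + 5 * n - 1, n - m))
          = (case p of (m, n) \<Rightarrow> theta_exp 1 2 m + theta_exp 5 10 n)" for p
        by (auto split: prod.split)
    qed (auto simp: norm_sign_def minus_one_power_square)
    then show ?thesis
      using theta_mult[of 1 2 5 10 "-1" "-1"] theta_eq_euler_prod[of 1] theta_eq_euler_prod[of 5]
          by simp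
  qed
  moreover have "?G 5 = ?G 1"
  proof (rule gen_fun_bij)
    have "(- t) mod 6 = 1 \<longleftrightarrow> t mod 6 = 5" "(- t) mod 6 = 5 \<longleftrightarrow> t mod 6 = 1" for t :: int
      by presburger+
    from this[of "x + y" for x y] show "bij_betw (\<lambda>(x, y). (- x, - y)) (L 5) (L 1)"
      by (intro bij_betw_byWitness[where f' = "\<lambda>(x, y). (- x, - y)"]) (auto simp: L_def)
  qed (auto simp: norm_exp_def norm_sign_def)
  moreover have "?G 3 = 0"
  proof -
    \<comment> \<open>With \<open>x = 3 + 6 a - b\<close> and \<open>y = b\<close> the form depends only on \<open>(3 + 6 a)\<^sup>2\<close> and on the
      product of \<open>b\<close> and \<open>b - 1 - 2 a\<close>. Negating \<open>3 + 6 a\<close> while exchanging these two factors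
      preserves it, and their difference is odd.\<close>
    let ?e = "\<lambda>(a, b). (6 * (b * (b - 1 - 2 * a)) + (3 + 6 * a)\<^sup>2 - 1) div 4"
    let ?s = "\<lambda>(a :: int, b :: int). if even b then 1 else -1 :: int"
    have "gen_fun UNIV ?e ?s = ?G 3"
    proof (rule gen_fun_bij)
      have "x + y = 3 + 6 * ((x + y) div 6)" if "(x + y) mod 6 = 3" for x y :: int
        using that by presburger
      moreover have "(3 + 6 * a) mod 6 = 3" "(3 + 6 * a) div 6 = a" for a :: int by presburger+
      ultimately show "bij_betw (\<lambda>(a, b). (3 + 6 * a - b, b)) UNIV (L 3)"
        by (intro bij_betw_byWitness[where f' = "\<lambda>(x, y). ((x + y) div 6, y)"])
          (auto simp: L_def algebra_simps)
      have "(3 + 6 * a - b)\<^sup>2 + 5 * b\<^sup>2 = 6 * (b * (b - 1 - 2 * a)) + (3 + 6 * a)\<^sup>2" for a b :: int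
        by (simp add: power2_eq_square algebra_simps)
      then show "norm_exp (case p of (a, b) \<Rightarrow> (3 + 6 * a - b, b)) = ?e p" for p
        by (simp add: norm_exp_def split: prod.split)
    qed (auto simp: norm_sign_def)
    moreover have "gen_fun UNIV ?e ?s = 0"
    proof (rule gen_fun_sign_reversing)
      show "bij_betw (\<lambda>(a, b). (-1 - a, b - 1 - 2 * a)) UNIV (UNIV :: (int \<times> int) set)"
        by (rule bij_betw_byWitness[where f' = "\<lambda>(a, b). (-1 - a, b - 1 - 2 * a)"]) auto
      fix p :: "int \<times> int"
      obtain a b where p: "p = (a, b)" by force
      have "6 * ((b - 1 - 2 * a) * ((b - 1 - 2 * a) - 1 - 2 * (-1 - a))) + (3 + 6 * (-1 - a))\<^sup>2
          = 6 * (b * (b - 1 - 2 * a)) + (3 + 6 * a)\<^sup>2"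
        by (simp add: power2_eq_square algebra_simps)
      then show "?e (case p of (a, b) \<Rightarrow> (-1 - a, b - 1 - 2 * a)) = ?e p" by (simp only: p prod.case)
      show "?s (case p of (a, b) \<Rightarrow> (-1 - a, b - 1 - 2 * a)) = - ?s p" by (simp add: p)
    qed
    ultimately show ?thesis by simp
  qed
  ultimately show ?thesis by simp
qed

section \<open>The Hecke relation at 2\<close>

lemma euler_prod_compose_X_power:
  assumes "d > 0" "m > 0"
  shows "euler_prod m oo fps_X ^ d = euler_prod (d * m)"
  using theta_compose_X_power[OF assms(1), of "-1" m "2 * m"] theta_eq_euler_prod[of m]
    theta_eq_euler_prod[of "d * m"] assms
  by (simp add: mult.left_commute)

definition eta_product :: "int fps" where
  "eta_product = euler_prod 1 ^ 4 * euler_prod 5 ^ 4"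

lemma Pstar_eq: "Pstar n = fps_nth eta_product n"
  by (simp add: Pstar_def eta_product_def)

lemma eta_product_compose_X_power_2:
  "eta_product oo fps_X ^ 2 = euler_prod 2 ^ 4 * euler_prod 10 ^ 4"
  by (simp add: eta_product_def fps_compose_mult_distrib euler_prod_compose_X_power
      flip: fps_compose_power)

text \<open>
  Write \<open>A\<close> and \<open>B\<close> for \<open>2 \<psi>(q\<^sup>2) \<phi>(q\<^sup>5)\<close> and \<open>2 \<phi>(q) \<psi>(q^10)\<close>. The sum over the norm form gives
  \<open>A - q B = 2 f\<^sub>1 f\<^sub>5\<close>, and \<open>\<psi>(q)\<^sup>2 = \<phi>(q) \<psi>(q\<^sup>2)\<close> makes \<open>A B f\<^sub>1\<^sup>2 f\<^sub>5\<^sup>2\<close> a product of Euler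
  products. The left hand side contains \<open>A\<^sup>2 + q\<^sup>2 B\<^sup>2 = (A - q B)\<^sup>2 + 2 q A B\<close>.
\<close>
lemma eta_product_odd_part:
  "(theta 1 2 0 ^ 2 * theta 1 5 5 ^ 2 + fps_X ^ 2 * (theta 1 1 1 ^ 2 * theta 1 10 0 ^ 2))
      * (euler_prod 1 ^ 2 * euler_prod 5 ^ 2)
     = 4 * eta_product + 8 * (fps_X * (euler_prod 2 ^ 4 * euler_prod 10 ^ 4))"
proof -
  define A B where "A = theta 1 2 0 * theta 1 5 5" and "B = theta 1 1 1 * theta 1 10 0"
  define E where "E = euler_prod 1 * euler_prod 5"
  have 1: "A - fps_X * B = 2 * E"
    using odd_lattice_theta odd_lattice_euler_prod by (simp add: A_def B_def E_def)
  have "4 * (A * B) = theta 1 1 0 ^ 2 * theta 1 5 0 ^ 2"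
    using theta_psi_square[of 1] theta_psi_square[of 5] by (simp add: A_def B_def)
  then have "4 * (A * B) * E ^ 2 = (theta 1 1 0 * euler_prod 1) ^ 2 * (theta 1 5 0 * euler_prod 5) ^ 2"
    by (simp only: E_def power_mult_distrib mult_ac)
  also have "\<dots> = 4 * (4 * (euler_prod 2 ^ 4 * euler_prod 10 ^ 4))"
    using theta_psi_eq_euler_prod[of 1] theta_psi_eq_euler_prod[of 5]
    by (simp add: power_mult_distrib flip: power_mult)
  finally have "4 * (A * B * E ^ 2 - 4 * (euler_prod 2 ^ 4 * euler_prod 10 ^ 4)) = 0"
    by (simp add: algebra_simps)
  then have 2: "A * B * E ^ 2 = 4 * (euler_prod 2 ^ 4 * euler_prod 10 ^ 4)"
    by (simp only: mult_eq_0_iff) simp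
  have "(A ^ 2 + fps_X ^ 2 * B ^ 2) * E ^ 2 = (A - fps_X * B) ^ 2 * E ^ 2 + 2 * fps_X * (A * B * E ^ 2)"
    by (simp add: power2_eq_square algebra_simps)
  also have "\<dots> = 4 * E ^ 4 + 8 * (fps_X * (euler_prod 2 ^ 4 * euler_prod 10 ^ 4))"
    unfolding 1 2 by (simp add: power2_eq_square power4_eq_xxxx algebra_simps)
  finally show ?thesis by (simp add: A_def B_def E_def eta_product_def power_mult_distrib)
qed

text \<open>
  From \<open>f\<^sub>1\<^sup>4 f\<^sub>5\<^sup>4 = \<phi>(-q)\<^sup>2 \<phi>(-q\<^sup>5)\<^sup>2 f\<^sub>2\<^sup>2 f\<^sub>10\<^sup>2\<close>, where the last two factors are even and the
  dissection of \<open>\<phi>(-q)\<^sup>2\<close> separates the parities in the first two. Only the odd part has to be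
  known explicitly.
\<close>
lemma eta_product_dissection:
  obtains G where "eta_product = (G oo fps_X ^ 2) -
    fps_X * ((4 * eta_product + 8 * (fps_X * (eta_product oo fps_X ^ 2))) oo fps_X ^ 2)"
proof -
  let ?E = "euler_prod 1 ^ 2 * euler_prod 5 ^ 2"
  let ?H = "theta 1 2 0 ^ 2 * theta 1 5 5 ^ 2 + fps_X ^ 2 * (theta 1 1 1 ^ 2 * theta 1 10 0 ^ 2)"
  define G where "G = (theta 1 1 1 ^ 2 * theta 1 5 5 ^ 2
      + fps_X ^ 3 * (theta 1 2 0 ^ 2 * theta 1 10 0 ^ 2)) * ?E"
  note compose = fps_compose_mult_distrib fps_compose_add_distrib fps_compose_power[symmetric]
    theta_compose_X_power euler_prod_compose_X_power
  have "eta_product = (euler_prod 1 ^ 2) ^ 2 * (euler_prod 5 ^ 2) ^ 2"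
    by (simp add: eta_product_def flip: power_mult)
  also have "\<dots> = (theta (-1) 1 1 ^ 2) * (theta (-1) 5 5 ^ 2) * (euler_prod 2 ^ 2 * euler_prod 10 ^ 2)"
  proof -
    have "euler_prod 1 ^ 2 = theta (-1) 1 1 * euler_prod 2"
        "euler_prod 5 ^ 2 = theta (-1) 5 5 * euler_prod 10"
      using theta_phi_minus_eq_euler_prod[of 1] theta_phi_minus_eq_euler_prod[of 5] by simp_all
    then show ?thesis by (simp only: power_mult_distrib mult_ac)
  qed
  also have "\<dots> = (theta 1 2 2 ^ 2 - fps_X * theta 1 4 0 ^ 2)
      * (theta 1 10 10 ^ 2 - fps_X ^ 5 * theta 1 20 0 ^ 2)
      * (euler_prod 2 ^ 2 * euler_prod 10 ^ 2)"
    using theta_phi_minus_square[of 1] theta_phi_minus_square[of 5] by simp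
  also have "\<dots> = (theta 1 2 2 ^ 2 * theta 1 10 10 ^ 2
      + (fps_X ^ 2) ^ 3 * (theta 1 4 0 ^ 2 * theta 1 20 0 ^ 2))
        * (euler_prod 2 ^ 2 * euler_prod 10 ^ 2)
      - fps_X * ((theta 1 4 0 ^ 2 * theta 1 10 10 ^ 2 + (fps_X ^ 2) ^ 2 *
          (theta 1 2 2 ^ 2 * theta 1 20 0 ^ 2))
        * (euler_prod 2 ^ 2 * euler_prod 10 ^ 2))"
  proof -
    have "(a - x * b) * (c - x ^ 5 * d) * e
        = (a * c + (x ^ 2) ^ 3 * (b * d)) * e - x * ((b * c + (x ^ 2) ^ 2 * (a * d)) * e)"
      for a b c d e x :: "int fps"
      by (simp add: eval_nat_numeral algebra_simps)
    then show ?thesis .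
  qed
  also have "\<dots> = (G oo fps_X ^ 2) - fps_X * ((?H * ?E) oo fps_X ^ 2)"
    by (simp add: G_def compose)
  finally show ?thesis
    unfolding eta_product_odd_part using that by (simp only: eta_product_compose_X_power_2)
qed

text \<open>
  In terms of \<open>a(n) = P\<^sup>*(n - 1)\<close> this is the Hecke relation \<open>a(2 n) = -4 a(n) - 8 a(n / 2)\<close> of
  the newform of weight 4 and level 5.
\<close>
lemma Pstar_odd:
  "Pstar (2 * n + 1) = - 4 * Pstar n - 8 * (if odd n then Pstar (n div 2) else 0)"
proof -
  obtain G where G: "eta_product = (G oo fps_X ^ 2) -
    fps_X * ((4 * eta_product + 8 * (fps_X * (eta_product oo fps_X ^ 2))) oo fps_X ^ 2)"
    by (rule eta_product_dissection)
  have "Pstar (2 * n + 1) = - fps_nth (4 * eta_product + 8 * (fps_X * (eta_product oo fps_X ^ 2))) n"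
  proof -
    have "fps_nth ((G oo fps_X ^ 2) - fps_X * (K oo fps_X ^ 2)) (2 * n + 1) = - fps_nth K n" for K
      by (simp add: fps_nth_compose_X_power)
    from this[of "4 * eta_product + 8 * (fps_X * (eta_product oo fps_X ^ 2))"] show ?thesis
      unfolding G[symmetric] Pstar_eq .
  qed
  also have "\<dots> = - 4 * Pstar n - 8 * fps_nth (fps_X * (eta_product oo fps_X ^ 2)) n"
    by (simp add: Pstar_eq numeral_fps_const)
  also have "fps_nth (fps_X * (eta_product oo fps_X ^ 2)) n = (if odd n then Pstar (n div 2) else 0)"
    by (cases n) (simp_all add: fps_nth_compose_X_power Pstar_eq)
  finally show ?thesis .
qed

text \<open>
  The recursion has order two, so two consecutive indices are carried along. The weaker power at
  the first of them holds already for \<open>\<alpha> = 0\<close>, where \<open>P\<^sup>*(0) = 1\<close> is odd, and it suffices because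
  the coefficient \<open>-8\<close> contributes three factors 2.
\<close>
lemma Pstar_dvd:
  "2 ^ \<alpha> dvd Pstar (2 ^ \<alpha> * n + 2 ^ \<alpha> - 1) \<and> 2 ^ (\<alpha> + 2) dvd Pstar (2 ^ Suc \<alpha> * n + 2 ^ Suc \<alpha> - 1)"
proof (induction \<alpha>)
  case 0
  have "4 dvd Pstar (2 * n + 1)" unfolding Pstar_odd by (intro dvd_diff) (auto intro: dvd_mult2)
  then show ?case by simp
next
  case (Suc \<alpha>)
  define m where "m = 2 ^ \<alpha> * n + 2 ^ \<alpha> - 1"
  have "(2 :: nat) ^ \<alpha> \<ge> 1" by simp
  then have "2 ^ \<alpha> * n + 2 ^ \<alpha> = m + 1" by (simp add: m_def)
  then have "2 ^ Suc \<alpha> * n + 2 ^ Suc \<alpha> = 2 * (m + 1)"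
      "2 ^ Suc (Suc \<alpha>) * n + 2 ^ Suc (Suc \<alpha>) = 4 * (m + 1)"
    unfolding power_Suc by (simp_all add: algebra_simps)
  then have m: "2 ^ Suc \<alpha> * n + 2 ^ Suc \<alpha> - 1 = 2 * m + 1"
      "2 ^ Suc (Suc \<alpha>) * n + 2 ^ Suc (Suc \<alpha>) - 1 = 2 * (2 * m + 1) + 1"
    by simp_all
  obtain s t where st: "Pstar m = 2 ^ \<alpha> * s" "Pstar (2 * m + 1) = 2 ^ (\<alpha> + 2) * t"
    using Suc.IH unfolding m m_def[symmetric] by (auto elim!: dvdE)
  have "Pstar (2 * (2 * m + 1) + 1) = 2 ^ (Suc \<alpha> + 2) * (- 2 * t - s)"
    unfolding Pstar_odd[of "2 * m + 1"] st by (simp add: st algebra_simps power_add)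
  then have "2 ^ (Suc \<alpha> + 2) dvd Pstar (2 * (2 * m + 1) + 1)" by (rule dvdI)
  moreover have "2 ^ Suc \<alpha> dvd Pstar (2 * m + 1)"
    unfolding st by (intro dvd_mult2 le_imp_power_dvd) simp
  ultimately show ?case unfolding m by simp
qed

theorem corollary1:
  fixes n \<alpha> :: nat
  assumes "\<alpha> \<ge> 1"
  shows "[Pstar (2 ^ \<alpha> * n + 2 ^ \<alpha> - 1) = 0] (mod 2 ^ (\<alpha> + 1))"
proof -
  obtain \<beta> where "\<alpha> = Suc \<beta>" using assms by (cases \<alpha>) auto
  then show ?thesis using Pstar_dvd[of \<beta> n] by (simp add: cong_0_iff)
qed

end
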